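(* Suppose $\varphi$ belongs to the Laguerre-Pólya class, $p$ and $q$ are real polynomials, and $\alpha\ge 0$ is a real number. Then $$Z_C\big(\varphi q p'+\alpha(\varphi q)'p\big)\le Z_C(p)+Z_C(q).$$
   Context: For a non-zero function $f$, $Z_C(f)$ denotes the number of non-real zeros of $f$ in $\mathbb{C}$, counted according to multiplicity; for the identically zero function, $Z_C(0)=0$. A real entire function $\varphi$ belongs to the Laguerre-Pólya class if it can be written in the form $$\varphi(x)=cx^me^{-ax^2+bx}\prod_{k=1}^{\omega}\left(1+\frac{x}{x_k}\right)e^{-x/x_k},$$ where $b,c\in\mathbb{R}$, $x_k\in\mathbb{R}\setminus\{0\}$, $m$ is a non-negative integer, $a\ge 0$, $0\le\omega\le\infty$, and $\sum_{k=1}^{\omega}x_k^{-2}<\infty$. Equivalently, $\varphi$ is the uniform limit on compact subsets of $\mathbb{C}$ of real polynomials having only real zeros. *)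

theory Defs
  imports
    "HOL-Complex_Analysis.Complex_Analysis"
    "HOL-Computational_Algebra.Polynomial"
    "HOL-Library.Extended_Nat"
begin

abbreviation cpoly :: "real poly \<Rightarrow> complex \<Rightarrow> complex" where
  "cpoly p \<equiv> poly (map_poly of_real p)"

definition real_entire :: "(complex \<Rightarrow> complex) \<Rightarrow> bool" where
  "real_entire f \<longleftrightarrow> f holomorphic_on UNIV \<and> (\<forall>z\<in>\<real>. f z \<in> \<real>)"

(* Intended for entire functions f. If such an f is not identically zero, each zero has a
   finite order zorder f z >= 1, so infinitely many non-real zeros give the count infinity. *)
definition Z_C :: "(complex \<Rightarrow> complex) \<Rightarrow> enat" where
  "Z_C f =
     (if \<forall>z. f z = 0 then 0
      else if finite {z. z \<notin> \<real> \<and> f z = 0}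
        then enat (\<Sum>z | z \<notin> \<real> \<and> f z = 0. nat (zorder f z))
      else \<infinity>)"

(* The factors are indexed from 0, so the indices in use are those k with enat k < omega;
   for finite omega the remaining factors are 1 and the remaining summands 0. Summability of
   the inverse squares makes the product converge at every z (to 0 at z = - x k). *)
definition laguerre_polya :: "(complex \<Rightarrow> complex) \<Rightarrow> bool" where
  "laguerre_polya \<phi> \<longleftrightarrow> real_entire \<phi> \<and>
     (\<exists>(a::real) (b::real) (c::real) (m::nat) (\<omega>::enat) (x :: nat \<Rightarrow> real).
        a \<ge> 0 \<and>
        (\<forall>k. enat k < \<omega> \<longrightarrow> x k \<noteq> 0) \<and>
        summable (\<lambda>k. if enat k < \<omega> then 1 / (x k)\<^sup>2 else 0) \<and>
        (\<forall>z. \<phi> z = of_real c * z ^ m * exp (- of_real a * z\<^sup>2 + of_real b * z) *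
               (\<Prod>k. if enat k < \<omega>
                      then (1 + z / of_real (x k)) * exp (- (z / of_real (x k)))
                      else 1)))"

end

theory Submission
  imports Defs "HOL-Computational_Algebra.Fundamental_Theorem_Algebra"
begin

text \<open>
  For polynomials the theorem is a counting form of Rolle's theorem. Let \<open>\<alpha> > 0\<close> and let \<open>f\<close> and \<open>p\<close> be
  real polynomials. Wherever \<open>f\<close> and \<open>p\<close> do not vanish, \<open>e = f p' + \<alpha> f' p\<close> agrees up to a non-vanishing
  factor with the derivative of \<open>\<bar>p\<bar> \<bar>f\<bar>\<^sup>\<alpha>\<close>. Hence \<open>e\<close> has a zero between any two consecutive real zeros
  of \<open>f p\<close>, and it keeps every multiple zero of \<open>f p\<close> with the multiplicity lowered by at most one. So
  \<open>e\<close> has at least \<open>N - 1\<close> real zeros, where \<open>N\<close> is the number of real zeros of \<open>f p\<close>. As the degree of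
  a non-zero \<open>e\<close> is at most \<open>degree f + degree p - 1\<close>, at most \<open>degree f + degree p - N\<close> zeros of \<open>e\<close> are non-real,
  and this is \<open>Z_C f + Z_C p\<close> (lemma \<open>Z_C_combination_cpoly_le\<close>). For \<open>f = R q\<close> with \<open>R\<close> real-rooted it is
  \<open>Z_C q + Z_C p\<close>.

  The general case follows by approximation, because the number of non-real zeros cannot increase
  in a locally uniform limit (lemma \<open>Z_C_locally_uniform_limit_le\<close>, a form of Hurwitz's theorem). By Cauchy's
  estimate locally uniform convergence of \<open>\<phi>\<close> carries over to the combination \<open>\<phi> q p' + \<alpha> (\<phi> q)' p\<close>,
  which contains a derivative of \<open>\<phi>\<close>. The bound therefore passes from real-rooted polynomials \<open>R\<close> to the
  functions \<open>R(z) exp (- a z\<^sup>2 + b z)\<close>, whose exponential is a limit of polynomials with real zeros, then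
  to their limits, the Weierstrass products that make up the Laguerre-Polya class, and from \<open>\<alpha> > 0\<close> to
  \<open>\<alpha> = 0\<close>.
\<close>

section \<open>Real polynomials on the complex plane\<close>

lemma map_poly_of_real_mult:
  fixes p q :: "real poly"
  shows "map_poly (of_real :: real \<Rightarrow> complex) (p * q) = map_poly of_real p * map_poly of_real q"
  by (rule poly_eqI) (simp add: coeff_map_poly coeff_mult)

lemma map_poly_of_real_add:
  fixes p q :: "real poly"
  shows "map_poly (of_real :: real \<Rightarrow> complex) (p + q) = map_poly of_real p + map_poly of_real q"
  by (rule poly_eqI) (simp add: coeff_map_poly)

lemma map_poly_of_real_smult:
  "map_poly (of_real :: real \<Rightarrow> complex) (smult c p) = smult (of_real c) (map_poly of_real p)"
  by (rule poly_eqI) (simp add: coeff_map_poly)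

lemma map_poly_of_real_power:
  "map_poly (of_real :: real \<Rightarrow> complex) (p ^ n) = map_poly of_real p ^ n"
  by (induction n) (simp_all add: map_poly_of_real_mult)

lemma map_poly_of_real_prod:
  "map_poly (of_real :: real \<Rightarrow> complex) (\<Prod>i\<in>A. p i) = (\<Prod>i\<in>A. map_poly of_real (p i))"
  by (induction A rule: infinite_finite_induct) (simp_all add: map_poly_of_real_mult)

lemma map_poly_of_real_pderiv:
  "map_poly (of_real :: real \<Rightarrow> complex) (pderiv p) = pderiv (map_poly of_real p)"
  by (rule poly_eqI) (simp add: coeff_map_poly coeff_pderiv)

lemma map_poly_of_real_eq_0_iff:
  "map_poly (of_real :: real \<Rightarrow> complex) p = 0 \<longleftrightarrow> p = 0"
  by (simp add: map_poly_eq_0_iff)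

lemma cpoly_of_real: "cpoly p (of_real x) = of_real (poly p x)"
  by (induction p) (simp_all add: map_poly_pCons)

lemma has_field_derivative_cpoly: "(cpoly p has_field_derivative cpoly (pderiv p) z) (at z)"
  by (simp add: map_poly_of_real_pderiv poly_DERIV)

lemma holomorphic_on_cpoly: "cpoly p holomorphic_on A"
  by (intro holomorphic_intros)

text \<open>
  Together with the fact that every complex polynomial splits, the equality of the real and the
  complex multiplicity at a real point turns the non-real zero count into
  a degree minus a count of real roots; only the latter occurs in Rolle arguments.
\<close>

lemma order_map_poly_of_real:
  assumes "p \<noteq> 0"
  shows "order (of_real x :: complex) (map_poly of_real p) = order x p"
proof -
  obtain q where q: "p = [:- x, 1:] ^ order x p * q" "\<not> [:- x, 1:] dvd q"
    using order_decomp[OF assms] by blast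
  have eq: "map_poly complex_of_real p
              = [:- of_real x, 1:] ^ order x p * map_poly of_real q"
    by (subst q(1)) (simp add: map_poly_of_real_mult map_poly_of_real_power map_poly_pCons)
  have nz: "poly q x \<noteq> 0"
    using q(2) by (simp add: poly_eq_0_iff_dvd)
  then have "q \<noteq> 0" by auto
  have "order (of_real x) (map_poly complex_of_real p) = order x p + order (of_real x) (map_poly complex_of_real q)"
    unfolding eq using \<open>q \<noteq> 0\<close>
    by (subst order_mult) (auto simp: map_poly_of_real_eq_0_iff order_power_n_n)
  moreover have "order (of_real x) (map_poly complex_of_real q) = 0"
    using nz by (intro order_0I) (simp add: cpoly_of_real)
  ultimately show ?thesis by simp
qed

lemma zorder_poly_eq_order:
  fixes P :: "complex poly"
  assumes "P \<noteq> 0"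
  shows "zorder (poly P) z = int (order z P)"
proof -
  obtain Q where Q: "P = [:- z, 1:] ^ order z P * Q" "\<not> [:- z, 1:] dvd Q"
    using order_decomp[OF assms] by blast
  show ?thesis
  proof (rule zorder_eqI)
    show "poly Q holomorphic_on UNIV" by (intro holomorphic_intros)
    show "poly Q z \<noteq> 0" using Q(2) by (simp add: poly_eq_0_iff_dvd)
    show "poly P w = poly Q w * (w - z) powi int (order z P)" for w
      by (subst Q(1)) (simp add: mult.commute)
  qed auto
qed

lemma size_proots_eq_sum_order:
  assumes "p \<noteq> 0"
  shows "size (proots p) = (\<Sum>x | poly p x = 0. order x p)"
  using assms by (simp add: size_multiset_overloaded_eq)

lemma Z_C_cpoly:
  assumes "p \<noteq> 0"
  shows "Z_C (cpoly p) = enat (degree p - size (proots p))"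
proof -
  let ?P = "map_poly complex_of_real p"
  let ?N = "{z. z \<notin> \<real> \<and> cpoly p z = 0}"
  let ?R = "of_real ` {x. poly p x = 0} :: complex set"
  have P0: "?P \<noteq> 0" using assms by (simp add: map_poly_of_real_eq_0_iff)
  have fin: "finite {z. cpoly p z = 0}" using P0 by (rule poly_roots_finite)
  have finN: "finite ?N" by (rule finite_subset[OF _ fin]) auto
  have finR: "finite ?R" using assms by (simp add: poly_roots_finite)
  have split: "{z. cpoly p z = 0} = ?N \<union> ?R"
    by (auto elim!: Reals_cases simp: cpoly_of_real)
  have "degree p = degree ?P" by (simp add: degree_map_poly)
  also have "\<dots> = size (proots ?P)" by (simp add: size_proots_complex)
  also have "\<dots> = (\<Sum>z\<in>?N \<union> ?R. order z ?P)"
    using P0 by (simp add: size_proots_eq_sum_order split)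
  also have "\<dots> = (\<Sum>z\<in>?N. order z ?P) + (\<Sum>z\<in>?R. order z ?P)"
    by (rule sum.union_disjoint) (use finN finR in auto)
  also have "(\<Sum>z\<in>?R. order z ?P) = size (proots p)"
    using assms by (simp add: sum.reindex inj_on_def order_map_poly_of_real size_proots_eq_sum_order)
  finally have deg: "degree p - size (proots p) = (\<Sum>z\<in>?N. order z ?P)" by simp
  have "\<exists>z. cpoly p z \<noteq> 0" using P0 poly_all_0_iff_0 by blast
  then show ?thesis
    using finN P0 by (auto simp: Z_C_def deg zorder_poly_eq_order)
qed

section \<open>Real roots between real roots\<close>

text \<open>
  A Rolle-type statement about consecutive points of \<open>S\<close> produces one point for each of the
  \<open>card S - 1\<close> gaps; they are distinct because the gaps are disjoint.
\<close>

lemma ex_interlacing_set: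
  fixes S :: "real set"
  assumes fin: "finite S" "S \<noteq> {}"
    and ex: "\<And>r s. \<lbrakk>r \<in> S; s \<in> S; r < s; {r<..<s} \<inter> S = {}\<rbrakk> \<Longrightarrow> \<exists>x. r < x \<and> x < s \<and> P x"
  shows "\<exists>T. finite T \<and> T \<inter> S = {} \<and> Suc (card T) = card S \<and> (\<forall>x\<in>T. P x)"
proof -
  define nxt where "nxt r = Min {s\<in>S. r < s}" for r
  let ?S' = "S - {Max S}"
  have nxt: "nxt r \<in> S" "r < nxt r" "{r<..<nxt r} \<inter> S = {}" if "r \<in> ?S'" for r
  proof -
    have "r < Max S" using that fin by (metis DiffD1 DiffD2 Max_ge insertI1 order_le_less)
    then have "{s\<in>S. r < s} \<noteq> {}" using fin Max_in by blast
    then have "nxt r \<in> {s\<in>S. r < s}" unfolding nxt_def using fin by (intro Min_in) auto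
    then show "nxt r \<in> S" "r < nxt r" by auto
    show "{r<..<nxt r} \<inter> S = {}"
    proof (rule ccontr)
      assume "{r<..<nxt r} \<inter> S \<noteq> {}"
      then obtain s where s: "r < s" "s < nxt r" "s \<in> S" by auto
      then have "nxt r \<le> s" unfolding nxt_def using fin by (intro Min_le) auto
      with s show False by simp
    qed
  qed
  have "\<exists>\<xi>. \<forall>r\<in>?S'. r < \<xi> r \<and> \<xi> r < nxt r \<and> P (\<xi> r)"
    by (rule bchoice) (use ex nxt in blast)
  then obtain \<xi> where \<xi>: "\<And>r. r \<in> ?S' \<Longrightarrow> r < \<xi> r \<and> \<xi> r < nxt r \<and> P (\<xi> r)" by blast
  have less: "\<xi> r < \<xi> r'" if "r \<in> ?S'" "r' \<in> ?S'" "r < r'" for r r'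
  proof -
    have "nxt r \<le> r'" using nxt(3)[OF that(1)] that by (metis DiffD1 IntI emptyE greaterThanLessThan_iff not_less)
    then show ?thesis using \<xi>[OF that(1)] \<xi>[OF that(2)] by simp
  qed
  have "inj_on \<xi> ?S'"
    by (rule inj_onI) (metis less linorder_neqE order_less_irrefl)
  then have "card (\<xi> ` ?S') = card S - 1" using fin by (simp add: card_image)
  moreover have "card S > 0" using fin by (simp add: card_gt_0_iff)
  moreover have "\<xi> ` ?S' \<inter> S = {}"
    using \<xi> nxt(3) by (auto simp: disjoint_iff)
  ultimately show ?thesis
    using fin \<xi> by (intro exI[of _ "\<xi> ` ?S'"]) auto
qed

text \<open>
  The combination \<open>f p' + \<alpha> f' p\<close> is, up to a factor without zeros in the interval, the derivative
  of \<open>\<bar>p\<bar> \<bar>f\<bar>\<^sup>\<alpha>\<close>. For \<open>\<alpha> > 0\<close> this function vanishes at a root of \<open>p\<close> as well as at a root of \<open>f\<close>, so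
  Rolle's theorem applies between any two consecutive roots of \<open>f p\<close>. For \<open>\<alpha> = 0\<close> roots of \<open>f\<close> would be
  lost.
\<close>

lemma ex_root_between:
  fixes f p :: "real poly"
  assumes \<alpha>: "\<alpha> > 0" and "r < s"
    and roots: "poly (f * p) r = 0" "poly (f * p) s = 0"
    and nz: "\<And>x. r < x \<Longrightarrow> x < s \<Longrightarrow> poly (f * p) x \<noteq> 0"
  shows "\<exists>x. r < x \<and> x < s \<and> poly (f * pderiv p + smult \<alpha> (pderiv f * p)) x = 0"
proof -
  \<comment> \<open>The square of \<open>\<bar>p\<bar> \<bar>f\<bar>\<^sup>\<alpha>\<close>, which avoids differentiating absolute values.\<close>
  define g where "g x = (poly p x)\<^sup>2 * ((poly f x)\<^sup>2) powr \<alpha>" for x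
  define g' where "g' x = 2 * poly p x * poly f x * ((poly f x)\<^sup>2) powr (\<alpha> - 1) *
      poly (f * pderiv p + smult \<alpha> (pderiv f * p)) x" for x
  have "\<exists>z. r < z \<and> z < s \<and> (\<lambda>v. g' z * v) = (\<lambda>v. 0)"
  proof (rule Rolle_deriv[OF \<open>r < s\<close>, of g])
    show "g r = g s" using roots \<alpha> by (auto simp: g_def)
    show "continuous_on {r..s} g"
      unfolding g_def using \<alpha> by (intro continuous_intros continuous_on_powr') auto
    fix x assume x: "r < x" "x < s"
    then have fx: "poly f x \<noteq> 0" using nz by auto
    then have "((poly f x)\<^sup>2) powr \<alpha> = (poly f x)\<^sup>2 * ((poly f x)\<^sup>2) powr (\<alpha> - 1)"
      by (simp add: powr_mult_base)
    then have "(g has_real_derivative g' x) (at x)"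
      unfolding g_def g'_def using fx
      by (auto intro!: derivative_eq_intros poly_DERIV DERIV_powr simp: field_simps power2_eq_square zero_less_mult_iff linorder_neq_iff)
    then show "(g has_derivative (\<lambda>v. g' x * v)) (at x)"
      by (simp add: has_field_derivative_def)
  qed
  then obtain z where z: "r < z" "z < s" "(\<lambda>v. g' z * v) = (\<lambda>v. 0)" by blast
  from fun_cong[OF z(3), of 1] have "g' z = 0" by simp
  then show ?thesis using nz[OF z(1,2)] z(1,2) by (auto simp: g'_def)
qed

lemma linear_power_dvd_pderiv:
  fixes p :: "real poly"
  assumes "[:- r, 1:] ^ n dvd p"
  shows "[:- r, 1:] ^ (n - 1) dvd pderiv p"
proof (cases n)
  case (Suc k)
  define l where "l = [:- r, 1:]"
  have l': "pderiv l = 1" by (simp add: l_def pderiv_pCons)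
  from assms obtain q where q: "p = l ^ n * q" unfolding l_def by (elim dvdE)
  have l'': "pderiv (l ^ n) = smult (of_nat n) (l ^ k)"
    by (simp only: Suc pderiv_power_Suc l' mult_1_right)
  have "pderiv p = l ^ n * pderiv q + q * pderiv (l ^ n)"
    by (simp only: q pderiv_mult)
  also have "\<dots> = l ^ k * (smult (of_nat n) q + l * pderiv q)"
    unfolding l'' by (simp add: Suc algebra_simps del: of_nat_Suc)
  finally have "pderiv p = l ^ k * (smult (of_nat n) q + l * pderiv q)" .
  then show ?thesis using Suc unfolding l_def by (metis diff_Suc_1 dvd_triv_left)
qed auto

text \<open>
  A root of \<open>f p\<close> of multiplicity \<open>k\<close> is a root of \<open>e\<close> of multiplicity at least \<open>k - 1\<close>. With \<open>d > 0\<close>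
  distinct roots the loss is at most \<open>d\<close>, and the \<open>d - 1\<close> roots of \<open>e\<close> in the gaps make up for all of it but one.
\<close>

lemma size_proots_combination_ge:
  fixes f p :: "real poly"
  assumes \<alpha>: "\<alpha> > 0" and "f \<noteq> 0" "p \<noteq> 0"
  defines "e \<equiv> f * pderiv p + smult \<alpha> (pderiv f * p)"
  assumes e: "e \<noteq> 0"
  shows "size (proots (f * p)) \<le> Suc (size (proots e))"
proof (cases "{x. poly (f * p) x = 0} = {}")
  case True
  have "f * p \<noteq> 0" using assms by simp
  then show ?thesis using True by (simp add: size_proots_eq_sum_order)
next
  case False
  let ?S = "{x. poly (f * p) x = 0}"
  have fp: "f * p \<noteq> 0" using assms by simp
  have finS: "finite ?S" using fp by (rule poly_roots_finite)
  have "\<exists>T. finite T \<and> T \<inter> ?S = {} \<and> Suc (card T) = card ?S \<and> (\<forall>x\<in>T. poly e x = 0)"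
  proof (rule ex_interlacing_set[OF finS False])
    fix r s assume rs: "r \<in> ?S" "s \<in> ?S" "r < s" "{r<..<s} \<inter> ?S = {}"
    have "poly (f * p) x \<noteq> 0" if "r < x" "x < s" for x
      using rs(4) that by (auto simp: disjoint_iff)
    then show "\<exists>x. r < x \<and> x < s \<and> poly e x = 0"
      unfolding e_def using ex_root_between[OF \<alpha> rs(3)] rs by blast
  qed
  then obtain T where T: "finite T" "T \<inter> ?S = {}" "Suc (card T) = card ?S" "\<And>x. x \<in> T \<Longrightarrow> poly e x = 0"
    by blast
  have ord: "order x (f * p) \<le> Suc (order x e)" for x
  proof -
    let ?l = "[:- x, 1:]" and ?m = "order x f" and ?n = "order x p"
    \<comment> \<open>If one multiplicity is 0, lowering it by one truncates; the other polynomial then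
      supplies the whole power.\<close>
    have "?l ^ (?m + ?n - 1) dvd f * pderiv p"
    proof (cases ?n)
      case 0
      have "?l ^ ?m dvd f" by (rule order_1)
      then show ?thesis using 0 by (metis add_0_right diff_le_self dvd_mult2 power_le_dvd)
    next
      case (Suc k)
      have "?l ^ ?m * ?l ^ (?n - 1) dvd f * pderiv p"
        by (intro mult_dvd_mono linear_power_dvd_pderiv order_1)
      then show ?thesis using Suc by (simp flip: power_add)
    qed
    moreover have "?l ^ (?m + ?n - 1) dvd pderiv f * p"
    proof (cases ?m)
      case 0
      have "?l ^ ?n dvd p" by (rule order_1)
      then show ?thesis using 0 by (metis add_0 diff_le_self dvd_mult power_le_dvd)
    next
      case (Suc k)
      have "?l ^ (?m - 1) * ?l ^ ?n dvd pderiv f * p"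
        by (intro mult_dvd_mono linear_power_dvd_pderiv order_1)
      then show ?thesis using Suc by (simp flip: power_add)
    qed
    ultimately have "?l ^ (?m + ?n - 1) dvd e"
      unfolding e_def by (intro dvd_add dvd_smult)
    then have "?m + ?n - 1 \<le> order x e" using e by (simp add: order_divides)
    then show ?thesis using fp by (simp add: order_mult)
  qed
  have "order x e \<ge> 1" if "x \<in> T" for x
    using T(4)[OF that] e by (simp add: order_root Suc_le_eq)
  then have T': "card T \<le> (\<Sum>x\<in>T. order x e)"
    using sum_mono[of T "\<lambda>_. 1" "\<lambda>x. order x e"] by simp
  have "size (proots (f * p)) = (\<Sum>x\<in>?S. order x (f * p))"
    using fp by (rule size_proots_eq_sum_order)
  also have "\<dots> \<le> (\<Sum>x\<in>?S. Suc (order x e))" by (rule sum_mono) (rule ord)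
  also have "\<dots> = (\<Sum>x\<in>?S. order x e) + card ?S" by (simp add: sum_Suc)
  also have "\<dots> \<le> Suc ((\<Sum>x\<in>?S. order x e) + (\<Sum>x\<in>T. order x e))"
    using T(3) T' by linarith
  also have "(\<Sum>x\<in>?S. order x e) + (\<Sum>x\<in>T. order x e) = (\<Sum>x\<in>?S \<union> T. order x e)"
    using finS T by (intro sum.union_disjoint[symmetric]) auto
  also have "\<dots> = (\<Sum>x\<in>(?S \<union> T) \<inter> {x. poly e x = 0}. order x e)"
    using finS T e by (intro sum.mono_neutral_right) (auto simp: order_root)
  also have "\<dots> \<le> (\<Sum>x | poly e x = 0. order x e)"
    using e by (intro sum_mono2) (auto simp: poly_roots_finite)
  also have "\<dots> = size (proots e)" using e by (simp add: size_proots_eq_sum_order)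
  finally show ?thesis by simp
qed

text \<open>
  The degree of a non-zero combination is smaller than \<open>degree f + degree p\<close>, and its number of real roots
  is smaller by at most one than that of \<open>f p\<close>. The two losses of one cancel in the difference.
\<close>

lemma Z_C_combination_cpoly_le:
  fixes f p :: "real poly"
  assumes \<alpha>: "\<alpha> > 0"
  shows "Z_C (cpoly (f * pderiv p + smult \<alpha> (pderiv f * p))) \<le> Z_C (cpoly p) + Z_C (cpoly f)"
proof (cases "f * pderiv p + smult \<alpha> (pderiv f * p) = 0")
  case True
  then show ?thesis by (simp add: Z_C_def)
next
  case False
  let ?e = "f * pderiv p + smult \<alpha> (pderiv f * p)"
  from False have nz: "f \<noteq> 0" "p \<noteq> 0" by auto
  have pos: "degree f + degree p > 0"
  proof (rule ccontr)
    assume "\<not> degree f + degree p > 0"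
    then have "pderiv p = 0" "pderiv f = 0" by (simp_all add: pderiv_eq_0_iff)
    with False show False by simp
  qed
  have d: "degree (f * pderiv p) \<le> degree f + degree p - 1" if "pderiv p \<noteq> 0" for f p :: "real poly"
  proof -
    have "degree p \<noteq> 0" using that by (simp add: pderiv_eq_0_iff)
    then show ?thesis using degree_mult_le[of f "pderiv p"] by (simp add: degree_pderiv)
  qed
  have "degree (f * pderiv p) \<le> degree f + degree p - 1"
    using d[of p f] by (cases "pderiv p = 0") auto
  moreover have "degree (smult \<alpha> (pderiv f * p)) \<le> degree f + degree p - 1"
    using d[of f p] \<alpha> by (cases "pderiv f = 0") (auto simp: mult.commute add.commute)
  ultimately have "degree ?e \<le> degree f + degree p - 1" by (rule degree_add_le)
  moreover have "size (proots f) + size (proots p) \<le> Suc (size (proots ?e))"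
    using size_proots_combination_ge[OF \<alpha> nz False] nz by (simp add: proots_mult)
  moreover have "size (proots f) \<le> degree f" "size (proots p) \<le> degree p"
    by (rule size_proots_le)+
  ultimately show ?thesis
    using pos by (simp add: Z_C_cpoly nz False)
qed

section \<open>Non-real zeros under locally uniform limits\<close>

text \<open>
  Uniform convergence on discs about the origin is the same as uniform convergence
  on compact sets.
\<close>

definition locally_uniform_limit :: "(nat \<Rightarrow> complex \<Rightarrow> complex) \<Rightarrow> (complex \<Rightarrow> complex) \<Rightarrow> bool" where
  "locally_uniform_limit f g \<longleftrightarrow> (\<forall>R. uniform_limit (cball 0 R) f g sequentially)"

lemma locally_uniform_limit_on_bounded:
  assumes "locally_uniform_limit f g" "bounded A"
  shows "uniform_limit A f g sequentially"
proof -
  from assms(2) obtain R where "A \<subseteq> cball 0 R"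
    using bounded_subset_ballD[of A 0] ball_subset_cball by (metis subset_trans)
  with assms(1) show ?thesis
    unfolding locally_uniform_limit_def by (blast intro: uniform_limit_on_subset)
qed

lemma finite_zeros_entire:
  assumes f: "f holomorphic_on UNIV" and nz: "f \<beta> \<noteq> 0" and "bounded A"
  shows "finite {z\<in>A. f z = 0}"
proof (cases "f constant_on UNIV")
  case True
  with nz have "f z \<noteq> 0" for z by (metis UNIV_I constant_on_def)
  then show ?thesis by simp
next
  case False
  have "compact (closure A)" using \<open>bounded A\<close> by (simp add: compact_closure)
  then have "finite {z\<in>closure A. f z = 0}"
    using f False by (intro holomorphic_compact_finite_zeros[of _ UNIV]) auto
  moreover have "{z\<in>A. f z = 0} \<subseteq> {z\<in>closure A. f z = 0}"
    using closure_subset by blast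
  ultimately show ?thesis by (rule finite_subset[rotated])
qed

lemma zorder_pos_entire:
  assumes "f holomorphic_on UNIV" "f \<beta> \<noteq> 0" "f z = 0"
  shows "zorder f z > 0"
  using zorder_exist_zero[of f UNIV z] assms by auto

text \<open>
  Hurwitz's theorem with multiplicities. Around an isolated zero of \<open>g\<close> take a circle on which \<open>g\<close> has no
  zero, so that \<open>\<bar>g\<bar> \<ge> \<delta> > 0\<close> there. Once \<open>\<bar>f n - g\<bar> < \<delta>\<close> on the circle, Rouche's theorem gives \<open>f n\<close> as
  many zeros inside as \<open>g\<close> has.
\<close>

lemma Hurwitz_zero_count_disc:
  assumes f: "\<And>n. f n holomorphic_on UNIV" and g: "g holomorphic_on UNIV"
    and lim: "locally_uniform_limit f g"
    and nz: "g \<beta> \<noteq> 0" and w: "g w = 0" and "\<epsilon> > 0"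
  shows "\<exists>\<rho>. 0 < \<rho> \<and> \<rho> < \<epsilon> \<and>
     (\<forall>\<^sub>F n in sequentially. (\<exists>z. f n z \<noteq> 0) \<and>
        (\<Sum>z\<in>{z\<in>ball w \<rho>. f n z = 0}. nat (zorder (f n) z)) = nat (zorder g w))"
proof -
  obtain r where r: "r > 0" "ball w r \<subseteq> UNIV"
    and iso: "\<And>z. z \<in> ball w r - {w} \<Longrightarrow> g z \<noteq> 0"
  proof (rule isolated_zeros[OF g open_UNIV connected_UNIV UNIV_I w UNIV_I nz])
    fix r assume "0 < r" "ball w r \<subseteq> UNIV" "\<And>z. z \<in> ball w r - {w} \<Longrightarrow> g z \<noteq> 0"
    then show thesis by (rule that)
  qed
  define \<rho> where "\<rho> = min r \<epsilon> / 2"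
  have \<rho>: "0 < \<rho>" "\<rho> < r" "\<rho> < \<epsilon>" using r \<open>\<epsilon> > 0\<close> by (auto simp: \<rho>_def min_def)
  have gnz: "g z \<noteq> 0" if "z \<in> sphere w \<rho>" for z
    using that \<rho> by (intro iso) (auto simp: dist_norm)
  have "\<exists>\<delta>>0. \<forall>z\<in>sphere w \<rho>. \<delta> \<le> norm (g z)"
  proof -
    have "continuous_on (sphere w \<rho>) (\<lambda>z. norm (g z))"
      by (intro continuous_on_norm holomorphic_on_imp_continuous_on holomorphic_on_subset[OF g]) auto
    moreover have "sphere w \<rho> \<noteq> {}" using \<rho> by simp
    ultimately obtain z0 where "z0 \<in> sphere w \<rho>" "\<forall>z\<in>sphere w \<rho>. norm (g z0) \<le> norm (g z)"
      using continuous_attains_inf[OF compact_sphere] by blast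
    then show ?thesis using gnz by (intro exI[of _ "norm (g z0)"]) auto
  qed
  then obtain \<delta> where \<delta>: "\<delta> > 0" "\<And>z. z \<in> sphere w \<rho> \<Longrightarrow> \<delta> \<le> norm (g z)" by blast
  have "\<forall>\<^sub>F n in sequentially. \<forall>z\<in>sphere w \<rho>. dist (f n z) (g z) < \<delta>"
    using locally_uniform_limit_on_bounded[OF lim, of "sphere w \<rho>"] \<delta>(1) by (simp add: uniform_limit_iff)
  then have "\<forall>\<^sub>F n in sequentially. (\<exists>z. f n z \<noteq> 0) \<and>
        (\<Sum>z\<in>{z\<in>ball w \<rho>. f n z = 0}. nat (zorder (f n) z)) = nat (zorder g w)"
  proof eventually_elim
    case (elim n)
    have close: "norm (f n z - g z) < norm (g z)" if "z \<in> sphere w \<rho>" for z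
      using bspec[OF elim that] \<delta>(2)[OF that] by (simp add: dist_norm)
    have fnz: "f n z \<noteq> 0" if "z \<in> sphere w \<rho>" for z
      using close[OF that] by auto
    have "w + of_real \<rho> \<in> sphere w \<rho>" using \<rho> by (simp add: dist_norm)
    then have ex: "f n (w + of_real \<rho>) \<noteq> 0" by (rule fnz)
    let ?s = "ball w r" and ?\<gamma> = "circlepath w \<rho>"
    let ?Z = "{z\<in>ball w \<rho>. f n z = 0}"
    have fin: "finite {z\<in>?s. f n z = 0}" by (rule finite_zeros_entire[OF f ex bounded_ball])
    have fing: "finite {z\<in>?s. g z = 0}" by (rule finite_zeros_entire[OF g nz bounded_ball])
    have inside: "winding_number ?\<gamma> z = 1" if "z \<in> ball w \<rho>" for z
      using that by (intro winding_number_circlepath) (simp add: dist_norm norm_minus_commute)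
    \<comment> \<open>The winding number is undetermined on the circle itself, where there are no zeros.\<close>
    have outside: "winding_number ?\<gamma> z = 0" if "z \<notin> cball w \<rho>" for z
      by (rule winding_number_zero_outside[of _ "cball w \<rho>"]) (use that \<rho> in auto)
    have "(\<Sum>z\<in>{z\<in>?s. g z + (f n z - g z) = 0}. winding_number ?\<gamma> z * zorder (\<lambda>z. g z + (f n z - g z)) z)
        = (\<Sum>z\<in>{z\<in>?s. g z = 0}. winding_number ?\<gamma> z * zorder g z)"
    proof (rule Rouche_theorem)
      show "g holomorphic_on ?s" "(\<lambda>z. f n z - g z) holomorphic_on ?s"
        using f g by (auto intro!: holomorphic_intros intro: holomorphic_on_subset)
      show "\<forall>z. z \<notin> ?s \<longrightarrow> winding_number ?\<gamma> z = 0" using outside \<rho> by auto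
    qed (use fin fing \<rho> close in \<open>auto simp: dist_norm\<close>)
    also have "{z\<in>?s. g z = 0} = {w}" using iso w r by auto
    also have "(\<Sum>z\<in>{w}. winding_number ?\<gamma> z * zorder g z) = zorder g w"
      using inside[of w] \<rho> by simp
    also have "{z\<in>?s. g z + (f n z - g z) = 0} = {z\<in>?s. f n z = 0}" by simp
    also have "(\<lambda>z. g z + (f n z - g z)) = f n" by auto
    also have "(\<Sum>z\<in>{z\<in>?s. f n z = 0}. winding_number ?\<gamma> z * zorder (f n) z)
             = (\<Sum>z\<in>?Z. winding_number ?\<gamma> z * zorder (f n) z)"
    proof (rule sum.mono_neutral_right[OF fin])
      show "\<forall>z\<in>{z\<in>?s. f n z = 0} - ?Z. winding_number ?\<gamma> z * zorder (f n) z = 0"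
        using outside fnz by (force simp: less_le)
    qed (use \<rho> in auto)
    also have "\<dots> = (\<Sum>z\<in>?Z. of_int (zorder (f n) z))"
      using inside by (intro sum.cong) auto
    also have "\<dots> = of_int (\<Sum>z\<in>?Z. zorder (f n) z)" by simp
    finally have eq: "(\<Sum>z\<in>?Z. zorder (f n) z) = zorder g w" by (simp only: of_int_eq_iff)
    have "int (\<Sum>z\<in>?Z. nat (zorder (f n) z)) = (\<Sum>z\<in>?Z. zorder (f n) z)"
      using zorder_pos_entire[OF f ex] by (auto intro!: sum.cong simp: less_imp_le)
    then have "(\<Sum>z\<in>?Z. nat (zorder (f n) z)) = nat (zorder g w)" using eq by (metis nat_int)
    then show ?case using ex by blast
  qed
  then show ?thesis using \<rho> by blast
qed

text \<open>
  Restricting to a finite set of non-real zeros of \<open>g\<close> makes one index \<open>n\<close> good for all of them at once,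
  and covers the case of infinitely many zeros too. The discs are chosen so small that they are disjoint
  and miss the real axis; the zeros of \<open>f n\<close> inside them are then distinct non-real zeros.
\<close>

lemma sum_zorder_le_if_Z_C_le:
  assumes f: "\<And>n. f n holomorphic_on UNIV" and g: "g holomorphic_on UNIV"
    and lim: "locally_uniform_limit f g"
    and nz: "g \<beta> \<noteq> 0"
    and bound: "\<And>n. Z_C (f n) \<le> enat m"
    and A: "finite A" "\<And>w. w \<in> A \<Longrightarrow> w \<notin> \<real> \<and> g w = 0"
  shows "(\<Sum>w\<in>A. nat (zorder g w)) \<le> m"
proof (cases "A = {}")
  case False
  \<comment> \<open>Radii below all distances to the real axis and all half distances between points of \<open>A\<close>.\<close>
  define D where "D = (\<lambda>w. \<bar>Im w\<bar>) ` A \<union> (\<lambda>(w, w'). dist w w' / 2) ` {(w, w') \<in> A \<times> A. w \<noteq> w'}"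
  define \<epsilon> where "\<epsilon> = Min D"
  have finD: "finite D" unfolding D_def using A(1)
    by (intro finite_UnI finite_imageI finite_subset[of "{(w, w') \<in> A \<times> A. w \<noteq> w'}" "A \<times> A"]) auto
  have "D \<noteq> {}" using False by (auto simp: D_def)
  moreover have "\<forall>d\<in>D. d > 0" using A(2) by (auto simp: D_def complex_is_Real_iff)
  ultimately have "\<epsilon> > 0" unfolding \<epsilon>_def using finD by simp
  have \<epsilon>1: "\<epsilon> \<le> \<bar>Im w\<bar>" if "w \<in> A" for w
    unfolding \<epsilon>_def using that by (intro Min_le finD) (auto simp: D_def)
  have \<epsilon>2: "\<epsilon> \<le> dist w w' / 2" if "w \<in> A" "w' \<in> A" "w \<noteq> w'" for w w'
    unfolding \<epsilon>_def using that by (intro Min_le finD) (force simp: D_def)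
  have "\<exists>\<rho>. \<forall>w\<in>A. 0 < \<rho> w \<and> \<rho> w < \<epsilon> \<and>
     (\<forall>\<^sub>F n in sequentially. (\<exists>z. f n z \<noteq> 0) \<and>
        (\<Sum>z\<in>{z\<in>ball w (\<rho> w). f n z = 0}. nat (zorder (f n) z)) = nat (zorder g w))"
    using Hurwitz_zero_count_disc[OF f g lim nz _ \<open>\<epsilon> > 0\<close>] A(2) by (intro bchoice) blast
  then obtain \<rho> where \<rho>: "\<And>w. w \<in> A \<Longrightarrow> 0 < \<rho> w \<and> \<rho> w < \<epsilon>"
    and ev: "\<And>w. w \<in> A \<Longrightarrow> \<forall>\<^sub>F n in sequentially. (\<exists>z. f n z \<noteq> 0) \<and>
        (\<Sum>z\<in>{z\<in>ball w (\<rho> w). f n z = 0}. nat (zorder (f n) z)) = nat (zorder g w)"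
    by blast
  have "\<forall>\<^sub>F n in sequentially. \<forall>w\<in>A. (\<exists>z. f n z \<noteq> 0) \<and>
        (\<Sum>z\<in>{z\<in>ball w (\<rho> w). f n z = 0}. nat (zorder (f n) z)) = nat (zorder g w)"
    using A(1) ev by (intro eventually_ball_finite) auto
  then obtain n where n: "\<And>w. w \<in> A \<Longrightarrow> (\<exists>z. f n z \<noteq> 0) \<and>
        (\<Sum>z\<in>{z\<in>ball w (\<rho> w). f n z = 0}. nat (zorder (f n) z)) = nat (zorder g w)"
    by (auto simp: eventually_sequentially)
  let ?Z = "\<lambda>w. {z\<in>ball w (\<rho> w). f n z = 0}" and ?N = "{z. z \<notin> \<real> \<and> f n z = 0}"
  obtain \<gamma> where \<gamma>: "f n \<gamma> \<noteq> 0" using n False by blast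
  from bound[of n] \<gamma> have finN: "finite ?N" and sumN: "(\<Sum>z\<in>?N. nat (zorder (f n) z)) \<le> m"
    by (auto simp: Z_C_def split: if_splits)
  have nonreal: "?Z w \<subseteq> ?N" if "w \<in> A" for w
  proof (safe, goal_cases)
    case (1 z)
    then have "\<bar>Im w\<bar> \<le> dist w z" using abs_Im_le_cmod[of "w - z"]
      by (simp add: complex_is_Real_iff dist_norm)
    with 1 \<rho>[OF that] \<epsilon>1[OF that] show False by simp
  qed
  have disj: "?Z w \<inter> ?Z w' = {}" if "w \<in> A" "w' \<in> A" "w \<noteq> w'" for w w'
  proof (rule ccontr)
    assume "?Z w \<inter> ?Z w' \<noteq> {}"
    then obtain z where "dist w z < \<rho> w" "dist w' z < \<rho> w'" by auto
    then show False
      using \<rho>[OF that(1)] \<rho>[OF that(2)] \<epsilon>2[OF that] dist_triangle2[of w w' z] by linarith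
  qed
  have "(\<Sum>w\<in>A. nat (zorder g w)) = (\<Sum>w\<in>A. \<Sum>z\<in>?Z w. nat (zorder (f n) z))"
    using n by (intro sum.cong) auto
  also have "\<dots> = (\<Sum>z\<in>(\<Union>w\<in>A. ?Z w). nat (zorder (f n) z))"
    using A(1) disj finite_zeros_entire[OF f \<gamma> bounded_ball]
    by (intro sum.UNION_disjoint[symmetric] ballI impI) blast+
  also have "\<dots> \<le> (\<Sum>z\<in>?N. nat (zorder (f n) z))"
    using nonreal by (intro sum_mono2 finN) auto
  finally show ?thesis using sumN by linarith
qed auto

text \<open>
  The non-real zero count is lower semicontinuous: in the limit non-real zeros can reach the real axis or
  escape to infinity, but none can appear. If \<open>g\<close> is identically zero, the convention \<open>Z_C 0 = 0\<close> makes
  the bound trivial.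
\<close>

lemma Z_C_locally_uniform_limit_le:
  assumes f: "\<And>n. f n holomorphic_on UNIV" and g: "g holomorphic_on UNIV"
    and lim: "locally_uniform_limit f g"
    and bound: "\<And>n. Z_C (f n) \<le> M"
  shows "Z_C g \<le> M"
proof (cases "\<forall>z. g z = 0")
  case True
  then show ?thesis by (simp add: Z_C_def)
next
  case False
  then obtain \<beta> where \<beta>: "g \<beta> \<noteq> 0" by blast
  show ?thesis
  proof (cases M)
    case (enat m)
    let ?N = "{z. z \<notin> \<real> \<and> g z = 0}"
    have le: "(\<Sum>w\<in>A. nat (zorder g w)) \<le> m" if "finite A" "A \<subseteq> ?N" for A
      by (rule sum_zorder_le_if_Z_C_le[OF f g lim \<beta> _ that(1)]) (use bound enat that(2) in auto)
    have "finite ?N"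
    proof (rule ccontr)
      assume "infinite ?N"
      then obtain A where A: "finite A" "card A = Suc m" "A \<subseteq> ?N"
        using infinite_arbitrarily_large by blast
      have "nat (zorder g w) \<ge> 1" if "w \<in> A" for w
        using zorder_pos_entire[OF g \<beta>, of w] A that by force
      then have "card A \<le> (\<Sum>w\<in>A. nat (zorder g w))"
        using sum_mono[of A "\<lambda>_. 1" "\<lambda>w. nat (zorder g w)"] by simp
      then show False using le[OF A(1,3)] A(2) by simp
    qed
    then show ?thesis using le[of ?N] enat False by (simp add: Z_C_def)
  qed simp
qed

section \<open>Stability of the bound under limits\<close>

text \<open>
  Cauchy's estimate on discs of radius one, applied to \<open>f n - g\<close>.
\<close>

lemma locally_uniform_limit_deriv:
  assumes f: "\<And>n. f n holomorphic_on UNIV" and g: "g holomorphic_on UNIV"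
    and lim: "locally_uniform_limit f g"
  shows "locally_uniform_limit (\<lambda>n. deriv (f n)) (deriv g)"
  unfolding locally_uniform_limit_def
proof (intro allI uniform_limitI)
  fix R e :: real assume "e > 0"
  have "\<forall>\<^sub>F n in sequentially. \<forall>z\<in>cball 0 (R + 1). dist (f n z) (g z) < e / 2"
    using \<open>e > 0\<close> by (intro uniform_limitD[OF locally_uniform_limit_on_bounded[OF lim bounded_cball]]) simp
  then show "\<forall>\<^sub>F n in sequentially. \<forall>z\<in>cball 0 R. dist (deriv (f n) z) (deriv g z) < e"
  proof eventually_elim
    case (elim n)
    show ?case
    proof
      fix z :: complex assume z: "z \<in> cball 0 R"
      have holo: "(\<lambda>z. f n z - g z) holomorphic_on A" for A
        by (intro holomorphic_on_diff holomorphic_on_subset[OF f] holomorphic_on_subset[OF g]) auto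
      have "norm ((deriv ^^ 1) (\<lambda>z. f n z - g z) z) \<le> fact 1 * (e / 2) / 1 ^ 1"
      proof (rule Cauchy_inequality)
        fix x assume "norm (z - x) = 1"
        then have "norm x \<le> R + 1"
          using z norm_triangle_ineq[of z "x - z"] by (simp add: norm_minus_commute)
        then show "norm (f n x - g x) \<le> e / 2" using elim by (auto simp: dist_norm intro: less_imp_le)
      qed (auto intro: holo holomorphic_on_imp_continuous_on)
      moreover have "deriv (\<lambda>z. f n z - g z) z = deriv (f n) z - deriv g z"
        using f g by (intro deriv_diff) (auto simp: holomorphic_on_def)
      ultimately show "dist (deriv (f n) z) (deriv g z) < e"
        using \<open>e > 0\<close> by (simp add: dist_norm)
    qed
  qed
qed

lemma bounded_image_cball_entire:
  fixes f :: "complex \<Rightarrow> complex"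
  assumes "f holomorphic_on UNIV"
  shows "bounded (f ` cball 0 R)"
  by (intro compact_imp_bounded compact_continuous_image holomorphic_on_imp_continuous_on
       holomorphic_on_subset[OF assms]) auto

lemma locally_uniform_limit_mult:
  assumes "locally_uniform_limit f g" "locally_uniform_limit h k"
    and "g holomorphic_on UNIV" "k holomorphic_on UNIV"
  shows "locally_uniform_limit (\<lambda>n z. f n z * h n z) (\<lambda>z. g z * k z)"
  using assms unfolding locally_uniform_limit_def
  by (auto intro!: uniform_lim_mult bounded_image_cball_entire)

lemma locally_uniform_limit_add:
  assumes "locally_uniform_limit f g" "locally_uniform_limit h k"
  shows "locally_uniform_limit (\<lambda>n z. f n z + h n z) (\<lambda>z. g z + k z)"
  using assms unfolding locally_uniform_limit_def by (auto intro!: uniform_limit_add)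

lemma locally_uniform_limit_const: "locally_uniform_limit (\<lambda>n. g) g"
  unfolding locally_uniform_limit_def by (auto intro!: uniform_limit_const)

lemma locally_uniform_limit_of_tendsto:
  assumes "c \<longlonglongrightarrow> l"
  shows "locally_uniform_limit (\<lambda>n z. c n) (\<lambda>z. l)"
  unfolding locally_uniform_limit_def uniform_limit_iff
  using tendstoD[OF assms] by (auto elim!: eventually_mono)

text \<open>
  Both \<open>\<phi>\<close> and \<open>\<alpha>\<close> are arguments because limits are taken in each of them.
\<close>

definition laguerre_combination ::
  "real \<Rightarrow> (complex \<Rightarrow> complex) \<Rightarrow> real poly \<Rightarrow> real poly \<Rightarrow> complex \<Rightarrow> complex" where
  "laguerre_combination \<alpha> \<phi> q p z = \<phi> z * cpoly q z * cpoly (pderiv p) z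
              + of_real \<alpha> * deriv (\<lambda>w. \<phi> w * cpoly q w) z * cpoly p z"

lemma holomorphic_laguerre_combination:
  assumes "\<phi> holomorphic_on UNIV"
  shows "laguerre_combination \<alpha> \<phi> q p holomorphic_on UNIV"
  unfolding laguerre_combination_def[abs_def]
  by (intro holomorphic_intros holomorphic_on_cpoly assms) auto

lemma locally_uniform_limit_laguerre_combination:
  assumes f: "\<And>n. f n holomorphic_on UNIV" and \<phi>: "\<phi> holomorphic_on UNIV"
    and lim: "locally_uniform_limit f \<phi>" and \<alpha>: "a \<longlonglongrightarrow> \<alpha>"
  shows "locally_uniform_limit (\<lambda>n. laguerre_combination (a n) (f n) q p) (laguerre_combination \<alpha> \<phi> q p)"
proof -
  have q: "locally_uniform_limit (\<lambda>n z. f n z * cpoly q z) (\<lambda>z. \<phi> z * cpoly q z)"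
    by (intro locally_uniform_limit_mult locally_uniform_limit_const lim \<phi> holomorphic_on_cpoly)
  have hq: "(\<lambda>z. g z * cpoly q z) holomorphic_on UNIV" if "g holomorphic_on UNIV" for g
    by (intro holomorphic_on_mult that holomorphic_on_cpoly)
  have "locally_uniform_limit (\<lambda>n. deriv (\<lambda>z. f n z * cpoly q z)) (deriv (\<lambda>z. \<phi> z * cpoly q z))"
    by (intro locally_uniform_limit_deriv hq f \<phi> q)
  moreover have "locally_uniform_limit (\<lambda>n z. complex_of_real (a n)) (\<lambda>z. of_real \<alpha>)"
    by (intro locally_uniform_limit_of_tendsto tendsto_of_real \<alpha>)
  ultimately show ?thesis
    unfolding laguerre_combination_def[abs_def]
    by (intro locally_uniform_limit_add locally_uniform_limit_mult locally_uniform_limit_const q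
         holomorphic_on_mult holomorphic_on_const holomorphic_on_cpoly hq \<phi> holomorphic_deriv open_UNIV)
qed

text \<open>
  The zero-counting bound, as a property of \<open>\<phi>\<close> that can be passed to limits. The restriction to positive
  \<open>\<alpha>\<close> matches the range in which the polynomial case is proved by Rolle's theorem.
\<close>

definition Z_C_bounding :: "(complex \<Rightarrow> complex) \<Rightarrow> bool" where
  "Z_C_bounding \<phi> \<longleftrightarrow> \<phi> holomorphic_on UNIV \<and>
     (\<forall>p q \<alpha>. \<alpha> > 0 \<longrightarrow> Z_C (laguerre_combination \<alpha> \<phi> q p) \<le> Z_C (cpoly p) + Z_C (cpoly q))"

lemma Z_C_bounding_locally_uniform_limit:
  assumes f: "\<And>n. Z_C_bounding (f n)" and \<phi>: "\<phi> holomorphic_on UNIV"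
    and lim: "locally_uniform_limit f \<phi>"
  shows "Z_C_bounding \<phi>"
  unfolding Z_C_bounding_def
proof (intro conjI allI impI \<phi>)
  fix p q :: "real poly" and \<alpha> :: real assume "\<alpha> > 0"
  have holo: "f n holomorphic_on UNIV" for n using f by (simp add: Z_C_bounding_def)
  show "Z_C (laguerre_combination \<alpha> \<phi> q p) \<le> Z_C (cpoly p) + Z_C (cpoly q)"
  proof (rule Z_C_locally_uniform_limit_le)
    show "locally_uniform_limit (\<lambda>n. laguerre_combination \<alpha> (f n) q p) (laguerre_combination \<alpha> \<phi> q p)"
      by (rule locally_uniform_limit_laguerre_combination[OF holo \<phi> lim tendsto_const])
    show "Z_C (laguerre_combination \<alpha> (f n) q p) \<le> Z_C (cpoly p) + Z_C (cpoly q)" for n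
      using f \<open>\<alpha> > 0\<close> by (simp add: Z_C_bounding_def)
  qed (intro holomorphic_laguerre_combination holo \<phi>)+
qed

text \<open>
  The case \<open>\<alpha> = 0\<close> is a limit of cases with positive parameter.
\<close>

lemma Z_C_bounding_nonneg:
  assumes "Z_C_bounding \<phi>" "\<alpha> \<ge> 0"
  shows "Z_C (laguerre_combination \<alpha> \<phi> q p) \<le> Z_C (cpoly p) + Z_C (cpoly q)"
proof (rule Z_C_locally_uniform_limit_le)
  have \<phi>: "\<phi> holomorphic_on UNIV" using assms(1) by (simp add: Z_C_bounding_def)
  have "(\<lambda>n. \<alpha> + inverse (real (Suc n))) \<longlonglongrightarrow> \<alpha> + 0"
    by (intro tendsto_add tendsto_const LIMSEQ_inverse_real_of_nat)
  then show "locally_uniform_limit (\<lambda>n. laguerre_combination (\<alpha> + inverse (real (Suc n))) \<phi> q p)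
         (laguerre_combination \<alpha> \<phi> q p)"
    by (intro locally_uniform_limit_laguerre_combination \<phi> locally_uniform_limit_const) simp
  show "Z_C (laguerre_combination (\<alpha> + inverse (real (Suc n))) \<phi> q p) \<le> Z_C (cpoly p) + Z_C (cpoly q)" for n
  proof -
    have "\<alpha> + inverse (real (Suc n)) > 0" using assms(2) by (intro add_nonneg_pos) auto
    then show ?thesis using assms(1) by (simp only: Z_C_bounding_def)
  qed
  show "laguerre_combination \<beta> \<phi> q p holomorphic_on UNIV" for \<beta>
    by (rule holomorphic_laguerre_combination[OF \<phi>])
  then show "laguerre_combination \<alpha> \<phi> q p holomorphic_on UNIV" .
qed

section \<open>From real-rooted polynomials to the Laguerre-Polya class\<close>

text \<open>
  Counting the roots with multiplicity against the degree says that all complex roots are real.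
\<close>

definition real_rooted :: "real poly \<Rightarrow> bool" where
  "real_rooted R \<longleftrightarrow> R \<noteq> 0 \<and> size (proots R) = degree R"

lemma real_rooted_const: "c \<noteq> 0 \<Longrightarrow> real_rooted [:c:]"
  by (simp add: real_rooted_def)

lemma real_rooted_mult: "real_rooted R \<Longrightarrow> real_rooted S \<Longrightarrow> real_rooted (R * S)"
  by (simp add: real_rooted_def proots_mult degree_mult_eq)

lemma real_rooted_power: "real_rooted R \<Longrightarrow> real_rooted (R ^ n)"
  by (induction n) (auto intro: real_rooted_mult simp: real_rooted_const[of 1, simplified] one_pCons)

lemma real_rooted_prod: "(\<And>i. i \<in> A \<Longrightarrow> real_rooted (R i)) \<Longrightarrow> real_rooted (\<Prod>i\<in>A. R i)"
  by (induction A rule: infinite_finite_induct)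
     (auto intro: real_rooted_mult simp: real_rooted_const[of 1, simplified] one_pCons)

lemma real_rooted_linear:
  assumes "c \<noteq> 0 \<or> d \<noteq> 0"
  shows "real_rooted [:c, d:]"
proof (cases "d = 0")
  case False
  have "[:c, d:] = [:d:] * [:c / d, 1:]" using False by simp
  also have "real_rooted \<dots>"
    using False by (intro real_rooted_mult real_rooted_const) (auto simp: real_rooted_def)
  finally show ?thesis .
qed (use assms in \<open>simp add: real_rooted_const\<close>)

lemma Z_C_bounding_cpoly:
  assumes "real_rooted R"
  shows "Z_C_bounding (cpoly R)"
  unfolding Z_C_bounding_def
proof (intro conjI allI impI holomorphic_on_cpoly)
  fix p q :: "real poly" and \<alpha> :: real assume \<alpha>: "\<alpha> > 0"
  have Rq: "(\<lambda>w. cpoly R w * cpoly q w) = cpoly (R * q)"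
    by (simp add: fun_eq_iff map_poly_of_real_mult)
  have "deriv (\<lambda>w. cpoly R w * cpoly q w) z = cpoly (pderiv (R * q)) z" for z
    unfolding Rq by (rule DERIV_imp_deriv[OF has_field_derivative_cpoly])
  then have eq: "laguerre_combination \<alpha> (cpoly R) q p
               = cpoly ((R * q) * pderiv p + smult \<alpha> (pderiv (R * q) * p))"
    by (auto simp: fun_eq_iff laguerre_combination_def map_poly_of_real_mult map_poly_of_real_add
          map_poly_of_real_smult)
  have "Z_C (cpoly (R * q)) \<le> Z_C (cpoly q)"
  proof (cases "q = 0")
    case False
    then show ?thesis
      using assms by (simp add: real_rooted_def Z_C_cpoly proots_mult degree_mult_eq)
  qed (simp add: Z_C_def)
  then show "Z_C (laguerre_combination \<alpha> (cpoly R) q p) \<le> Z_C (cpoly p) + Z_C (cpoly q)"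
    unfolding eq using Z_C_combination_cpoly_le[OF \<alpha>, of "R * q" p] by (meson add_left_mono order_trans)
qed

text \<open>
  With \<open>v = u / n\<close> compare \<open>(1 + v)\<^sup>n\<close> with \<open>(exp v)\<^sup>n\<close>. Both bases have norm at most \<open>r = exp \<bar>v\<bar>\<close>; after
  division by \<open>r\<close> they lie in the unit disc, where taking \<open>n\<close>-th powers magnifies distances by a factor
  of at most \<open>n\<close>.
\<close>

lemma norm_exp_diff_power_le:
  fixes u :: complex
  assumes "n > 0"
  shows "norm ((1 + u / of_nat n) ^ n - exp u) \<le> exp (norm u) * (norm u)\<^sup>2 / n"
proof -
  define v where "v = u / of_nat n"
  define r where "r = exp (norm v)"
  have r: "r > 0" by (simp add: r_def)
  have nv: "norm v = norm u / n" by (simp add: v_def norm_divide)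
  have "norm (1 + v) \<le> 1 + norm v" using norm_triangle_ineq[of 1 v] by simp
  also have "\<dots> \<le> r" unfolding r_def by (rule exp_ge_add_one_self)
  finally have 1: "norm ((1 + v) / of_real r) \<le> 1" using r by (simp add: norm_divide)
  have 2: "norm (exp v / of_real r) \<le> 1" using r norm_exp[of v] by (simp add: norm_divide r_def)
  have rn: "r ^ n = exp (norm u)"
    using assms by (simp add: r_def nv flip: exp_of_nat_mult)
  have vn: "exp v ^ n = exp u"
    using assms by (simp add: v_def flip: exp_of_nat_mult)
  have "norm (exp v - (1 + v)) \<le> r * (norm v)\<^sup>2"
    using Taylor_exp_field[of v 1] by (simp add: r_def power2_eq_square)
  then have 3: "norm ((1 + v) / of_real r - exp v / of_real r) \<le> (norm v)\<^sup>2"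
    using r by (simp add: norm_divide divide_le_eq mult.commute norm_minus_commute flip: diff_divide_distrib)
  have "norm ((1 + v) ^ n - exp u) = r ^ n * norm (((1 + v) / of_real r) ^ n - (exp v / of_real r) ^ n)"
    using r by (simp add: power_divide vn norm_divide norm_power flip: diff_divide_distrib)
  also have "\<dots> \<le> r ^ n * (n * norm ((1 + v) / of_real r - exp v / of_real r))"
    using r by (intro mult_left_mono norm_power_diff 1 2) auto
  also have "\<dots> \<le> r ^ n * (n * (norm v)\<^sup>2)"
    using r 3 by (intro mult_left_mono) auto
  also have "\<dots> = exp (norm u) * (norm u)\<^sup>2 / n"
    using assms by (simp add: rn nv power2_eq_square)
  finally show ?thesis by (simp add: v_def)
qed

lemma locally_uniform_limit_exp:
  assumes "h holomorphic_on UNIV"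
  shows "locally_uniform_limit (\<lambda>n z. (1 + h z / of_nat (Suc n)) ^ Suc n) (\<lambda>z. exp (h z))"
  unfolding locally_uniform_limit_def
proof (intro allI uniform_limitI)
  fix R e :: real assume "e > 0"
  obtain B where B: "B > 0" "\<And>z. z \<in> cball 0 R \<Longrightarrow> norm (h z) \<le> B"
    using bounded_image_cball_entire[OF assms, of R] by (auto simp: bounded_pos)
  have "(\<lambda>n. exp B * B\<^sup>2 * inverse (real (Suc n))) \<longlonglongrightarrow> exp B * B\<^sup>2 * 0"
    by (intro tendsto_mult tendsto_const LIMSEQ_inverse_real_of_nat)
  then have "\<forall>\<^sub>F n in sequentially. exp B * B\<^sup>2 * inverse (real (Suc n)) < e"
    using \<open>e > 0\<close> by (intro order_tendstoD(2)[of _ "exp B * B\<^sup>2 * 0"]) auto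
  then show "\<forall>\<^sub>F n in sequentially. \<forall>z\<in>cball 0 R.
      dist ((1 + h z / of_nat (Suc n)) ^ Suc n) (exp (h z)) < e"
  proof eventually_elim
    case (elim n)
    show ?case
    proof
      fix z :: complex assume "z \<in> cball 0 R"
      then have z: "norm (h z) \<le> B" by (rule B)
      have "dist ((1 + h z / of_nat (Suc n)) ^ Suc n) (exp (h z))
             \<le> exp (norm (h z)) * (norm (h z))\<^sup>2 / real (Suc n)"
        unfolding dist_norm by (rule norm_exp_diff_power_le) simp
      also have "\<dots> \<le> exp B * B\<^sup>2 / real (Suc n)"
        using z by (intro divide_right_mono mult_mono power_mono) auto
      finally show "dist ((1 + h z / of_nat (Suc n)) ^ Suc n) (exp (h z)) < e"
        using elim by (simp add: divide_inverse)
    qed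
  qed
qed

text \<open>
  The factor \<open>exp (- a z\<^sup>2 + b z)\<close> is the limit of \<open>(1 + b z / n)\<^sup>n (1 - a z\<^sup>2 / n)\<^sup>n\<close>. Because of \<open>a \<ge> 0\<close> the
  quadratic factor has only real roots.
\<close>

lemma Z_C_bounding_cpoly_exp:
  assumes "real_rooted R" "a \<ge> 0"
  shows "Z_C_bounding (\<lambda>z. cpoly R z * exp (- of_real a * z\<^sup>2 + of_real b * z))"
proof (rule Z_C_bounding_locally_uniform_limit)
  \<comment> \<open>\<open>1 - a z\<^sup>2 / (n + 1) = (1 + s n z) (1 - s n z)\<close>\<close>
  define s where "s n = sqrt (a / real (Suc n))" for n
  define P where "P n = R * ([:1, b / real (Suc n):] ^ Suc n * ([:1, s n:] * [:1, - s n:]) ^ Suc n)" for n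
  have "real_rooted (P n)" for n
    unfolding P_def by (intro real_rooted_mult real_rooted_power real_rooted_linear assms) auto
  then show "Z_C_bounding (cpoly (P n))" for n by (rule Z_C_bounding_cpoly)
  have s2: "complex_of_real (s n) * of_real (s n) = of_real a / of_nat (Suc n)" for n
  proof -
    have "s n * s n = a / real (Suc n)" using assms(2) by (simp add: s_def)
    then show ?thesis by (metis of_real_mult of_real_divide of_real_of_nat_eq)
  qed
  have "cpoly ([:1, s n:] * [:1, - s n:]) z = 1 + (- of_real a * z\<^sup>2) / of_nat (Suc n)" for n z
  proof -
    have "cpoly ([:1, s n:] * [:1, - s n:]) z = 1 - (of_real (s n) * of_real (s n)) * z\<^sup>2"
      unfolding map_poly_of_real_mult
      by (simp add: map_poly_pCons algebra_simps power2_eq_square)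
    then show ?thesis by (simp add: s2)
  qed
  then have "cpoly (P n) z = cpoly R z * ((1 + (of_real b * z) / of_nat (Suc n)) ^ Suc n *
                 (1 + (- of_real a * z\<^sup>2) / of_nat (Suc n)) ^ Suc n)" for n z
    unfolding P_def map_poly_of_real_mult[of R] map_poly_of_real_mult[of "_ ^ _"] map_poly_of_real_power
    by (simp add: map_poly_pCons mult.commute del: power_Suc of_nat_Suc)
  then have eq: "(\<lambda>n. cpoly (P n)) = (\<lambda>n z. cpoly R z * ((1 + (of_real b * z) / of_nat (Suc n)) ^ Suc n *
                 (1 + (- of_real a * z\<^sup>2) / of_nat (Suc n)) ^ Suc n))"
    by (intro ext)
  have eq': "(\<lambda>z. cpoly R z * exp (- of_real a * z\<^sup>2 + of_real b * z))
       = (\<lambda>z. cpoly R z * (exp (of_real b * z) * exp (- of_real a * z\<^sup>2)))"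
    by (intro ext) (simp only: exp_add mult.commute)
  show "locally_uniform_limit (\<lambda>n. cpoly (P n)) (\<lambda>z. cpoly R z * exp (- of_real a * z\<^sup>2 + of_real b * z))"
    unfolding eq eq'
    by (intro locally_uniform_limit_mult locally_uniform_limit_const locally_uniform_limit_exp
         holomorphic_intros)
  show "(\<lambda>z. cpoly R z * exp (- of_real a * z\<^sup>2 + of_real b * z)) holomorphic_on UNIV"
    by (intro holomorphic_intros)
qed

text \<open>
  Each factor is the Weierstrass factor of genus one at \<open>- t\<^sub>k z\<close>, which differs from 1 by at most
  \<open>3 \<bar>t\<^sub>k z\<bar>\<^sup>2\<close> once \<open>\<bar>t\<^sub>k z\<bar> \<le> 1 / 2\<close>. The parameters \<open>t\<^sub>k\<close> are the reciprocals of the \<open>x\<^sub>k\<close> in the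
  Laguerre-Polya product; the value \<open>t\<^sub>k = 0\<close> gives the constant factor 1, so finite products need no
  separate treatment.
\<close>

lemma locally_uniform_limit_weierstrass_prod:
  fixes t :: "nat \<Rightarrow> real"
  assumes sm: "summable (\<lambda>k. (t k)\<^sup>2)"
  defines "F \<equiv> \<lambda>k z. (1 + of_real (t k) * z) * exp (- (of_real (t k) * z))"
  shows "locally_uniform_limit (\<lambda>n z. \<Prod>k<n. F k z) (\<lambda>z. \<Prod>k. F k z)"
proof -
  have bound: "\<forall>\<^sub>F k in sequentially. \<forall>z\<in>cball 0 R. norm (F k z - 1) \<le> 3 * R\<^sup>2 * (t k)\<^sup>2" for R
  proof -
    have "(\<lambda>k. R\<^sup>2 * (t k)\<^sup>2) \<longlonglongrightarrow> R\<^sup>2 * 0"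
      by (intro tendsto_mult tendsto_const summable_LIMSEQ_zero sm)
    then have "\<forall>\<^sub>F k in sequentially. R\<^sup>2 * (t k)\<^sup>2 < (1/2)\<^sup>2"
      by (intro order_tendstoD(2)[of _ "R\<^sup>2 * 0"]) (auto simp: power2_eq_square)
    then show ?thesis
    proof eventually_elim
      case (elim k)
      show ?case
      proof
        fix z :: complex assume "z \<in> cball 0 R"
        then have "(norm z)\<^sup>2 \<le> R\<^sup>2" by (intro power_mono) auto
        then have le: "(norm (- (of_real (t k) * z)))\<^sup>2 \<le> R\<^sup>2 * (t k)\<^sup>2"
          using mult_right_mono[OF _ zero_le_power2, of "(norm z)\<^sup>2" "R\<^sup>2" "t k"]
          by (simp add: norm_mult power_mult_distrib mult.commute)
        then have "(norm (- (of_real (t k) * z)))\<^sup>2 \<le> (1/2)\<^sup>2" using elim by linarith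
        then have "norm (- (of_real (t k) * z)) \<le> 1/2" by (rule power2_le_imp_le) simp
        then have "norm (weierstrass_factor 1 (- (of_real (t k) * z)) - 1)
                     \<le> 3 * (norm (- (of_real (t k) * z)))\<^sup>2"
          using weierstrass_factor_bound[of "- (of_real (t k) * z)" 1] by (simp add: numeral_2_eq_2)
        also have "weierstrass_factor 1 (- (of_real (t k) * z)) = F k z"
          by (simp add: weierstrass_factor_def F_def)
        finally show "norm (F k z - 1) \<le> 3 * R\<^sup>2 * (t k)\<^sup>2" using le by simp
      qed
    qed
  qed
  have sm': "summable (\<lambda>k. 3 * R\<^sup>2 * (t k)\<^sup>2)" for R by (intro summable_mult sm)
  have conv: "convergent_prod (\<lambda>k. F k z)" for z
  proof -
    have "\<forall>\<^sub>F k in sequentially. norm (norm (F k z - 1)) \<le> 3 * (norm z)\<^sup>2 * (t k)\<^sup>2"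
      using bound[of "norm z"] by eventually_elim auto
    then have "summable (\<lambda>k. norm (F k z - 1))"
      using sm' by (rule summable_comparison_test_ev)
    then show ?thesis
      by (intro abs_convergent_prod_imp_convergent_prod) (simp add: abs_convergent_prod_conv_summable)
  qed
  show ?thesis
    unfolding locally_uniform_limit_def
  proof
    fix R :: real
    have "uniformly_convergent_on (cball 0 R) (\<lambda>n z. \<Prod>k<n. F k z)"
    proof (rule uniformly_convergent_on_prod')
      show "uniformly_convergent_on (cball 0 R) (\<lambda>n z. \<Sum>k<n. norm (F k z - 1))"
        by (rule Weierstrass_m_test'_ev[OF _ sm'[of R]]) (use bound[of R] in simp)
      show "continuous_on (cball 0 R) (F k)" for k
        unfolding F_def by (intro continuous_intros)
    qed simp
    then obtain g where g: "uniform_limit (cball 0 R) (\<lambda>n z. \<Prod>k<n. F k z) g sequentially"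
      by (auto simp: uniformly_convergent_on_def)
    have "g z = (\<Prod>k. F k z)" if "z \<in> cball 0 R" for z
    proof (rule LIMSEQ_unique)
      show "(\<lambda>n. \<Prod>k<n. F k z) \<longlonglongrightarrow> g z" by (rule tendsto_uniform_limitI[OF g that])
      have "(\<lambda>n. \<Prod>k\<le>n. F k z) \<longlonglongrightarrow> (\<Prod>k. F k z)" by (rule convergent_prod_LIMSEQ[OF conv])
      then show "(\<lambda>n. \<Prod>k<n. F k z) \<longlonglongrightarrow> (\<Prod>k. F k z)"
        unfolding lessThan_Suc_atMost[symmetric] by (rule filterlim_sequentially_Suc[THEN iffD1])
    qed
    then show "uniform_limit (cball 0 R) (\<lambda>n z. \<Prod>k<n. F k z) (\<lambda>z. \<Prod>k. F k z) sequentially"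
      using g by (metis (no_types, lifting) uniform_limit_cong')
  qed
qed

text \<open>
  The convergence factors of a partial product combine to \<open>exp (- T z)\<close> with a real constant \<open>T\<close>. This
  only changes the coefficient \<open>b\<close>, so every partial product is a real-rooted polynomial
  times an exponential of the kind already treated.
\<close>

lemma Z_C_bounding_laguerre_polya:
  assumes "laguerre_polya \<phi>" and "\<phi> \<beta> \<noteq> 0"
  shows "Z_C_bounding \<phi>"
proof -
  from assms(1) obtain a b c :: real and m :: nat and \<omega> :: enat and x :: "nat \<Rightarrow> real"
    where a: "a \<ge> 0"
      and sm: "summable (\<lambda>k. if enat k < \<omega> then 1 / (x k)\<^sup>2 else 0)"
      and \<phi>: "\<And>z. \<phi> z = of_real c * z ^ m * exp (- of_real a * z\<^sup>2 + of_real b * z) *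
               (\<Prod>k. if enat k < \<omega>
                      then (1 + z / of_real (x k)) * exp (- (z / of_real (x k)))
                      else 1)"
      and holo: "\<phi> holomorphic_on UNIV"
    unfolding laguerre_polya_def real_entire_def by blast
  \<comment> \<open>Real-rooted polynomials are non-zero, which is where \<open>\<phi> \<beta> \<noteq> 0\<close> is used.\<close>
  have "c \<noteq> 0" using assms(2) by (auto simp: \<phi>)
  define t where "t k = (if enat k < \<omega> then 1 / x k else 0)" for k
  define F where "F k z = (1 + of_real (t k) * z) * exp (- (of_real (t k) * z))" for k and z :: complex
  define H where "H z = of_real c * z ^ m * exp (- of_real a * z\<^sup>2 + of_real b * z)" for z :: complex
  have "(\<lambda>k. (t k)\<^sup>2) = (\<lambda>k. if enat k < \<omega> then 1 / (x k)\<^sup>2 else 0)"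
    by (auto simp: t_def power_divide)
  with sm have sm': "summable (\<lambda>k. (t k)\<^sup>2)" by simp
  have F: "(if enat k < \<omega> then (1 + z / of_real (x k)) * exp (- (z / of_real (x k))) else 1) = F k z"
    for k z by (simp add: F_def t_def)
  have \<phi>': "\<phi> = (\<lambda>z. H z * (\<Prod>k. F k z))" by (simp add: fun_eq_iff \<phi> F H_def)
  have Hholo: "H holomorphic_on UNIV" unfolding H_def by (intro holomorphic_intros)
  have lim: "locally_uniform_limit (\<lambda>n z. \<Prod>k<n. F k z) (\<lambda>z. \<Prod>k. F k z)"
    using locally_uniform_limit_weierstrass_prod[OF sm'] by (simp add: F_def)
  have Pholo: "(\<lambda>z. \<Prod>k. F k z) holomorphic_on UNIV"
  proof (rule holomorphic_uniform_sequence)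
    show "(\<lambda>z. \<Prod>k<n. F k z) holomorphic_on UNIV" for n
      unfolding F_def by (intro holomorphic_intros)
    fix z :: complex
    show "\<exists>d>0. cball z d \<subseteq> UNIV \<and> uniform_limit (cball z d) (\<lambda>n z. \<Prod>k<n. F k z) (\<lambda>z. \<Prod>k. F k z) sequentially"
      using locally_uniform_limit_on_bounded[OF lim, of "cball z 1"] by (intro exI[of _ 1]) auto
  qed auto
  show ?thesis
  proof (rule Z_C_bounding_locally_uniform_limit[OF _ holo])
    show "locally_uniform_limit (\<lambda>n z. H z * (\<Prod>k<n. F k z)) \<phi>"
      unfolding \<phi>' by (intro locally_uniform_limit_mult locally_uniform_limit_const lim Hholo Pholo)
    fix n
    define R where "R = [:c:] * [:0, 1:] ^ m * (\<Prod>k<n. [:1, t k:])"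
    have "real_rooted R"
      unfolding R_def using \<open>c \<noteq> 0\<close>
      by (intro real_rooted_mult real_rooted_const real_rooted_power real_rooted_prod real_rooted_linear) auto
    have R: "cpoly R z = of_real c * z ^ m * (\<Prod>k<n. 1 + of_real (t k) * z)" for z
      unfolding R_def map_poly_of_real_mult map_poly_of_real_power map_poly_of_real_prod
      by (simp add: map_poly_pCons poly_prod mult.commute)
    define T where "T = (\<Sum>k<n. t k)"
    have T: "(\<Prod>k<n. exp (- (of_real (t k) * z))) = exp (- (of_real T * z))" for z :: complex
      by (simp add: T_def sum_distrib_right flip: sum_negf exp_sum)
    have bT: "exp (- of_real a * z\<^sup>2 + of_real (b - T) * z)
        = exp (- of_real a * z\<^sup>2 + of_real b * z) * exp (- (of_real T * z))" for z :: complex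
      by (simp add: algebra_simps flip: exp_add)
    have "(\<Prod>k<n. F k z) = (\<Prod>k<n. 1 + of_real (t k) * z) * exp (- (of_real T * z))" for z
      by (simp only: F_def prod.distrib T)
    then have "H z * (\<Prod>k<n. F k z) = cpoly R z * exp (- of_real a * z\<^sup>2 + of_real (b - T) * z)" for z
      unfolding H_def R bT by (simp only: mult_ac)
    then show "Z_C_bounding (\<lambda>z. H z * (\<Prod>k<n. F k z))"
      using Z_C_bounding_cpoly_exp[OF \<open>real_rooted R\<close> a, of "b - T"] by simp
  qed
qed

theorem theorem18:
  fixes \<phi> :: "complex \<Rightarrow> complex" and p q :: "real poly" and \<alpha> :: real
  assumes "laguerre_polya \<phi>" and "\<alpha> \<ge> 0"
  shows "Z_C (\<lambda>z. \<phi> z * cpoly q z * cpoly (pderiv p) z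
              + of_real \<alpha> * deriv (\<lambda>w. \<phi> w * cpoly q w) z * cpoly p z)
         \<le> Z_C (cpoly p) + Z_C (cpoly q)"
proof (cases "\<forall>z. \<phi> z = 0")
  case True
  then show ?thesis by (simp add: Z_C_def)
next
  case False
  then obtain \<beta> where "\<phi> \<beta> \<noteq> 0" by blast
  then have "Z_C_bounding \<phi>" using assms(1) by (intro Z_C_bounding_laguerre_polya)
  then show ?thesis
    using Z_C_bounding_nonneg[OF _ assms(2), of \<phi> q p] by (simp add: laguerre_combination_def[abs_def])
qed

end
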